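(* Let $\mathcal{H}$ be a hypergraph, $S,B \subseteq V(\mathcal{H})$ and $x \in S$. Let $\mathcal{H}_1 := \mathcal{H} \setminus \mathcal{H}(x)$ and $\mathcal{H}_2 := \mathcal{H} \setminus (\mathcal{H}(B) \cap \mathcal{H}(x))$. Then \[ \#\mathsf{btr}_{B}(\mathcal{H},S) = \#\mathsf{btr}_{B}(\mathcal{H},S\setminus\{x\}) + \#\mathsf{btr}_{B}(\mathcal{H}_1,S\setminus\{x\}) - \#\mathsf{btr}_{B \cup \{x\}}(\mathcal{H}_2,S\setminus\{x\}), \] where $\#$ denotes cardinality.
   Context: A hypergraph $\mathcal{H}$ is a finite collection of subsets (hyperedges) of a finite ground set; $V(\mathcal{H})=\bigcup_{e\in\mathcal{H}} e$. Any subset of $\mathcal{H}$ is a sub-hypergraph. For $S\subseteq V(\mathcal{H})$, $\mathcal{H}(S)=\{e\in\mathcal{H}\mid e\cap S\neq\emptyset\}$ and $\mathcal{H}(x)=\mathcal{H}(\{x\})$. A transversal of $\mathcal{H}$ is a set $T\subseteq V(\mathcal{H})$ meeting every hyperedge; $\mathsf{tr}(\mathcal{H})$ is the set of transversals and $\mathsf{mtr}(\mathcal{H})$ the set of inclusion-wise minimal ones ($\mathsf{mtr}(\emptyset)=\{\emptyset\}$). For a sub-hypergraph $\mathcal{H}'\subseteq\mathcal{H}$ and $B\subseteq V(\mathcal{H})$, $\mathsf{btr}_B(\mathcal{H}')=\mathsf{tr}(\mathcal{H}')\cap\mathsf{mtr}(\mathcal{H}'\setminus\mathcal{H}'(B))$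 (the $B$-blocked transversals: transversals $T$ of $\mathcal{H}'$ in which every $x\in T$ has some $e\in\mathcal{H}'\setminus\mathcal{H}'(B)$ with $e\cap T=\{x\}$). For $S\subseteq V(\mathcal{H})$, $\mathsf{btr}_B(\mathcal{H}',S)=\{T\in\mathsf{btr}_B(\mathcal{H}')\mid T\subseteq S\}$. *)

theory Defs
  imports Main
begin

type_synonym 'a hypergraph = "'a set set"

definition is_hypergraph :: "'a hypergraph \<Rightarrow> bool" where
  "is_hypergraph H \<longleftrightarrow> (\<exists>X. finite X \<and> H \<subseteq> Pow X)"

definition verts :: "'a hypergraph \<Rightarrow> 'a set" where
  "verts H = (\<Union>e\<in>H. e)"

definition edges_at :: "'a hypergraph \<Rightarrow> 'a set \<Rightarrow> 'a hypergraph" where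
  "edges_at H S = {e \<in> H. e \<inter> S \<noteq> {}}"

definition tr :: "'a hypergraph \<Rightarrow> 'a set set" where
  "tr H = {T. T \<subseteq> verts H \<and> (\<forall>e\<in>H. e \<inter> T \<noteq> {})}"

definition mtr :: "'a hypergraph \<Rightarrow> 'a set set" where
  "mtr H = {T \<in> tr H. \<forall>T'\<in>tr H. T' \<subseteq> T \<longrightarrow> T' = T}"

definition btr :: "'a set \<Rightarrow> 'a hypergraph \<Rightarrow> 'a set set" where
  "btr B H = tr H \<inter> mtr (H - edges_at H B)"

definition btr_in :: "'a set \<Rightarrow> 'a hypergraph \<Rightarrow> 'a set \<Rightarrow> 'a set set" where
  "btr_in B H S = {T \<in> btr B H. T \<subseteq> S}"

lemma mtr_empty: "mtr {} = {{}}"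
  by (auto simp: mtr_def tr_def verts_def)

lemma btr_iff_private_edge:
  "T \<in> btr B H \<longleftrightarrow>
    T \<in> tr H \<and> (\<forall>x\<in>T. \<exists>e \<in> H - edges_at H B. e \<inter> T = {x})"
proof
  assume T: "T \<in> btr B H"
  let ?K = "H - edges_at H B"
  have "\<exists>e\<in>?K. e \<inter> T = {x}" if x: "x \<in> T" for x
  proof (rule ccontr)
    assume no: "\<not> (\<exists>e\<in>?K. e \<inter> T = {x})"
    have TK: "T \<in> tr ?K" and min: "\<And>T'. T' \<in> tr ?K \<Longrightarrow> T' \<subseteq> T \<Longrightarrow> T' = T"
      using T by (auto simp: btr_def mtr_def)
    have "e \<inter> (T - {x}) \<noteq> {}" if "e \<in> ?K" for e
    proof -
      have "e \<inter> T \<noteq> {}" using TK that by (auto simp: tr_def)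
      moreover have "e \<inter> T \<noteq> {x}" using no that by blast
      ultimately show ?thesis by blast
    qed
    then have "T - {x} \<in> tr ?K" using TK by (auto simp: tr_def)
    from min[OF this] x show False by blast
  qed
  then show "T \<in> tr H \<and> (\<forall>x\<in>T. \<exists>e \<in> ?K. e \<inter> T = {x})"
    using T by (auto simp: btr_def)
next
  let ?K = "H - edges_at H B"
  assume T: "T \<in> tr H \<and> (\<forall>x\<in>T. \<exists>e \<in> ?K. e \<inter> T = {x})"
  have "T \<subseteq> verts ?K"
  proof
    fix x assume "x \<in> T"
    then obtain e where "e \<in> ?K" "e \<inter> T = {x}" using T by blast
    then show "x \<in> verts ?K" unfolding verts_def by blast
  qed
  then have TK: "T \<in> tr ?K" using T by (auto simp: tr_def)
  have "T' = T" if T': "T' \<in> tr ?K" "T' \<subseteq> T" for T'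
  proof
    show "T \<subseteq> T'"
    proof
      fix x assume "x \<in> T"
      then obtain e where "e \<in> ?K" "e \<inter> T = {x}" using T by blast
      moreover from this obtain y where "y \<in> e" "y \<in> T'" using T' unfolding tr_def by blast
      moreover from this have "y \<in> e \<inter> T" using T' by blast
      ultimately show "x \<in> T'" by simp
    qed
  qed (use T' in simp)
  then show "T \<in> btr B H" using T TK by (simp add: btr_def mtr_def)
qed

end

(* Split the members of btr B H inside S according to whether they contain x. Those that do
   correspond, by deleting x, to the T in btr B H1 inside S - {x} such that x has a private edge
   for insert x T, that is, such that some edge through x avoids both B and T. The T in btr B H1
   for which this fails meet every edge through x that avoids B, so they are exactly the members
   of btr (B \<union> {x}) H2. *)
theory Submission
  imports Defs
begin

lemma in_btr_iff:
  "T \<in> btr B H \<longleftrightarrow> (\<forall>e\<in>H. e \<inter> T \<noteq> {}) \<and> (\<forall>y\<in>T. \<exists>e\<in>H. e \<inter> B = {} \<and> e \<inter> T = {y})"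
proof -
  have sub: "T \<subseteq> verts H" if "\<forall>y\<in>T. \<exists>e\<in>H. e \<inter> B = {} \<and> e \<inter> T = {y}"
    using that unfolding verts_def by blast
  have private_edge: "(\<exists>e\<in>H - edges_at H B. e \<inter> T = {y}) \<longleftrightarrow> (\<exists>e\<in>H. e \<inter> B = {} \<and> e \<inter> T = {y})" for y
    by (auto simp: edges_at_def)
  show ?thesis
    unfolding btr_iff_private_edge tr_def mem_Collect_eq private_edge using sub by argo
qed

lemma finite_btr_in: "finite S \<Longrightarrow> finite (btr_in B H S)"
  by (rule finite_subset[of _ "Pow S"]) (auto simp: btr_in_def)

lemma finite_verts: "is_hypergraph H \<Longrightarrow> finite (verts H)"
  unfolding is_hypergraph_def verts_def by (auto intro: finite_subset)

text \<open>An edge through \<open>x\<close> is already hit by \<open>x\<close> and cannot be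
  private to any \<open>y \<in> T\<close>, so everything asked of \<open>T\<close> concerns only the
  edges missing \<open>x\<close>. What remains is a private edge for \<open>x\<close>
  itself.\<close>

lemma insert_in_btr_iff:
  assumes "x \<notin> T"
  shows "insert x T \<in> btr B H \<longleftrightarrow>
    T \<in> btr B (H - edges_at H {x}) \<and> (\<exists>e\<in>H. x \<in> e \<and> e \<inter> B = {} \<and> e \<inter> T = {})"
    (is "_ \<longleftrightarrow> _ \<and> ?priv")
proof -
  have transversal: "(\<forall>e\<in>H. e \<inter> insert x T \<noteq> {}) \<longleftrightarrow> (\<forall>e\<in>H - edges_at H {x}. e \<inter> T \<noteq> {})"
    by (auto simp: edges_at_def)
  have private_y: "(\<exists>e\<in>H. e \<inter> B = {} \<and> e \<inter> insert x T = {y}) \<longleftrightarrow>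
      (\<exists>e\<in>H - edges_at H {x}. e \<inter> B = {} \<and> e \<inter> T = {y})" if "y \<in> T" for y
  proof -
    have "e \<inter> insert x T = {y} \<longleftrightarrow> x \<notin> e \<and> e \<inter> T = {y}" for e
      using that assms by auto
    then show ?thesis by (auto simp: edges_at_def)
  qed
  have "e \<inter> insert x T = {x} \<longleftrightarrow> x \<in> e \<and> e \<inter> T = {}" for e
    using assms by auto
  then have private_x: "(\<exists>e\<in>H. e \<inter> B = {} \<and> e \<inter> insert x T = {x}) \<longleftrightarrow> ?priv"
    by auto
  show ?thesis
    \<comment> \<open>\<open>ball_simps(7)\<close> separates \<open>x\<close> from the points of
      \<open>T\<close>; \<open>ball_cong\<close> supplies the premise \<open>y \<in> T\<close> of
      \<open>private_y\<close>.\<close>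
    unfolding in_btr_iff transversal ball_simps(7) private_x by (simp only: private_y conj_ac cong: ball_cong)
qed

text \<open>\<open>?H2\<close> is \<open>?H1\<close> together with the edges through
  \<open>x\<close> that avoid \<open>B\<close>. Blocking \<open>x\<close> stops these extra edges
  from being private, so they only add the demand that \<open>T\<close> meet them.\<close>

lemma in_btr_Un_iff:
  "T \<in> btr (B \<union> {x}) (H - (edges_at H B \<inter> edges_at H {x})) \<longleftrightarrow>
    T \<in> btr B (H - edges_at H {x}) \<and> \<not> (\<exists>e\<in>H. x \<in> e \<and> e \<inter> B = {} \<and> e \<inter> T = {})"
proof -
  let ?H1 = "H - edges_at H {x}" and ?H2 = "H - (edges_at H B \<inter> edges_at H {x})"
  have transversal: "(\<forall>e\<in>?H2. e \<inter> T \<noteq> {}) \<longleftrightarrow>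
      (\<forall>e\<in>?H1. e \<inter> T \<noteq> {}) \<and> \<not> (\<exists>e\<in>H. x \<in> e \<and> e \<inter> B = {} \<and> e \<inter> T = {})"
    unfolding edges_at_def by blast
  have private_edge: "(\<exists>e\<in>?H2. e \<inter> (B \<union> {x}) = {} \<and> e \<inter> T = {y}) \<longleftrightarrow>
      (\<exists>e\<in>?H1. e \<inter> B = {} \<and> e \<inter> T = {y})" for y
    unfolding edges_at_def by blast
  show ?thesis
    unfolding in_btr_iff transversal private_edge by argo
qed

theorem theorem1:
  fixes H H1 H2 :: "'a hypergraph" and S B :: "'a set" and x :: 'a
  assumes "is_hypergraph H"
    and "S \<subseteq> verts H" and "B \<subseteq> verts H" and "x \<in> S"
    and "H1 = H - edges_at H {x}"
    and "H2 = H - (edges_at H B \<inter> edges_at H {x})"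
  shows "int (card (btr_in B H S)) =
    int (card (btr_in B H (S - {x}))) + int (card (btr_in B H1 (S - {x})))
      - int (card (btr_in (B \<union> {x}) H2 (S - {x})))"
proof -
  let ?S' = "S - {x}"
  let ?P = "{T. T \<subseteq> ?S' \<and> insert x T \<in> btr B H}"
  have fin: "finite S"
    using finite_verts assms(1,2) finite_subset by blast
  then have fin_P: "finite ?P"
    by (auto intro: finite_subset[of _ "Pow ?S'"])
  have "btr_in B H S = btr_in B H ?S' \<union> insert x ` ?P"
  proof (intro set_eqI iffI)
    fix T assume T: "T \<in> btr_in B H S"
    show "T \<in> btr_in B H ?S' \<union> insert x ` ?P"
    proof (cases "x \<in> T")
      case True
      then have "T = insert x (T - {x})" "T - {x} \<in> ?P"
        using T by (auto simp: btr_in_def insert_absorb)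
      then show ?thesis by blast
    qed (use T in \<open>auto simp: btr_in_def\<close>)
  qed (use \<open>x \<in> S\<close> in \<open>auto simp: btr_in_def\<close>)
  moreover have "btr_in B H ?S' \<inter> insert x ` ?P = {}"
    by (auto simp: btr_in_def)
  \<comment> \<open>No member of \<open>?P\<close> contains \<open>x\<close>, so \<open>x\<close>
    can be cancelled.\<close>
  moreover have "inj_on (insert x) ?P"
    using insert_ident[of x] by (auto simp: inj_on_def subset_Diff_insert)
  ultimately have split_H: "card (btr_in B H S) = card (btr_in B H ?S') + card ?P"
    using fin fin_P by (simp add: card_Un_disjoint card_image finite_btr_in)
  have P_iff: "T \<in> ?P \<longleftrightarrow> T \<subseteq> ?S' \<and> T \<in> btr B H1 \<and>
      (\<exists>e\<in>H. x \<in> e \<and> e \<inter> B = {} \<and> e \<inter> T = {})" for T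
    using insert_in_btr_iff[of x T B H] assms(5) by blast
  \<comment> \<open>The two parts differ by the existence of a private edge for \<open>x\<close> and
    its negation; counting them eliminates \<open>card ?P\<close> from
    \<open>split_H\<close>.\<close>
  have "btr_in B H1 ?S' = ?P \<union> btr_in (B \<union> {x}) H2 ?S'"
    by (rule set_eqI, unfold Un_iff P_iff btr_in_def mem_Collect_eq assms(5,6) in_btr_Un_iff) argo
  moreover have "?P \<inter> btr_in (B \<union> {x}) H2 ?S' = {}"
    unfolding disjoint_iff P_iff btr_in_def mem_Collect_eq assms(6) in_btr_Un_iff by simp
  ultimately have "card (btr_in B H1 ?S') = card ?P + card (btr_in (B \<union> {x}) H2 ?S')"
    using fin fin_P by (simp add: card_Un_disjoint finite_btr_in)
  with split_H show ?thesis by simp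
qed

end
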